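(* Let $b,c$ be positive integers, let $\mathcal{A}$ be the cluster algebra of $(b,c)$-type with no frozen variables, and let $\Bbbk$ be a field. - Assume either $c>1$ or $\operatorname{char}(\Bbbk)$ divides $b$. For each $\alpha\in\Bbbk^\times$ such that $\alpha^b=-1$, there is a deep point in $V(\mathcal{A},\Bbbk)$ defined by $$p(x_i)=\begin{cases}0&\text{if } i\text{ is even},\\ \alpha&\text{if } i\equiv1\bmod 4,\\ \alpha^{-1}&\text{if } i\equiv3\bmod4.\end{cases}$$ - Assume either $b>1$ or $\operatorname{char}(\Bbbk)$ divides $c$. For each $\alpha\in\Bbbk^\times$ such that $\alpha^c=-1$, there is a deep point in $V(\mathcal{A},\Bbbk)$ defined by $$p(x_i)=\begin{cases}0&\text{if } i\text{ is odd},\\ \alpha&\text{if } i\equiv2\bmod 4,\\ \alpha^{-1}&\text{if } i\equiv0\bmod4.\end{cases}$$ Every deep point in $V(\mathcal{A},\Bbbk)$ is one of these two mutually exclusive types (under the corresponding assumption on $b$, $c$ and $\operatorname{char}(\Bbbk)$).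
   Context: The cluster algebra of $(b,c)$-type with no frozen variables is the cluster algebra over $\mathbb{Z}$ with exchange matrix $\begin{bmatrix}0&b\\-c&0\end{bmatrix}$: it is the subring of $\mathbb{Q}(x_1,x_2)$ generated by the elements $x_i$, $i\in\mathbb{Z}$ (the cluster variables), determined recursively by $$x_{i-1}x_{i+1}=\begin{cases}x_i^b+1&\text{if } i \text{ is odd},\\ x_i^c+1&\text{if } i\text{ is even}.\end{cases}$$ The clusters are $\{x_i,x_{i+1}\}$, $i\in\mathbb{Z}$. $V(\mathcal{A},\Bbbk)=\mathrm{Hom}_{\mathrm{Ring}}(\mathcal{A},\Bbbk)$. A point $p$ is deep if for every $i\in\mathbb{Z}$ at least one of $p(x_i),p(x_{i+1})$ is $0$. "$\operatorname{char}(\Bbbk)$ divides $b$" means $b=0$ in $\Bbbk$. *)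

theory Defs
  imports
    "HOL-Algebra.Generated_Rings"
    "HOL-Algebra.Algebraic_Closure_Type"
    "HOL-Library.FuncSet"
begin

text \<open>
  The field of rational functions in two variables over the rationals is modelled as the
  fraction field of \<open>\<rat>[x\<^sub>1][x\<^sub>2]\<close>: the inner polynomial variable is \<open>x\<^sub>1\<close> and the outer
  one is \<open>x\<^sub>2\<close>.
\<close>

type_synonym ratfun2 = "rat poly poly fract"

definition X1 :: ratfun2 where
  "X1 = Fract [:[:0, 1:]:] 1"

definition X2 :: ratfun2 where
  "X2 = Fract [:0, 1:] 1"

definition exchange_exp :: "nat \<Rightarrow> nat \<Rightarrow> int \<Rightarrow> nat" where
  "exchange_exp b c i = (if odd i then b else c)"

text \<open>
  The cluster variables are computed from \<open>x\<^sub>1, x\<^sub>2\<close> by solving the exchange relation at \<open>i - 1\<close>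
  for \<open>x\<^sub>i\<close> when \<open>i > 2\<close>, and the one at \<open>i + 1\<close> for \<open>x\<^sub>i\<close> when \<open>i < 1\<close>. The divisions are
  genuine, since all cluster variables are nonzero; see \<open>exchange_relation\<close> below.
\<close>

function cluster_var :: "nat \<Rightarrow> nat \<Rightarrow> int \<Rightarrow> ratfun2" where
  "cluster_var b c i =
    (if i = 1 then X1
     else if i = 2 then X2
     else if i > 2 then
       (cluster_var b c (i - 1) ^ exchange_exp b c (i - 1) + 1) / cluster_var b c (i - 2)
     else
       (cluster_var b c (i + 1) ^ exchange_exp b c (i + 1) + 1) / cluster_var b c (i + 2))"
  by pat_completeness auto
termination
  by (relation "measure (\<lambda>(b, c, i). nat \<bar>2 * i - 3\<bar>)") auto

declare cluster_var.simps [simp del]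

lemma cluster_var_pos: "cluster_var b c i > 0"
proof (induction b c i rule: cluster_var.induct)
  case (1 b c i)
  have "X1 > 0" "X2 > 0"
    by (simp_all add: X1_def X2_def zero_less_Fract_iff less_poly_def pos_poly_def)
  then show ?case
    using 1 by (subst cluster_var.simps) (auto intro!: divide_pos_pos add_pos_pos)
qed

lemma exchange_relation:
  "cluster_var b c (i - 1) * cluster_var b c (i + 1) =
    (if odd i then cluster_var b c i ^ b + 1 else cluster_var b c i ^ c + 1)"
proof (cases "i \<ge> 2")
  case True
  then show ?thesis
    using cluster_var_pos[of b c "i - 1"]
    by (subst (2) cluster_var.simps) (auto simp: exchange_exp_def)
next
  case False
  then show ?thesis
    using cluster_var_pos[of b c "i + 1"]
    by (subst (1) cluster_var.simps) (auto simp: exchange_exp_def add.commute)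
qed

definition cluster_algebra :: "nat \<Rightarrow> nat \<Rightarrow> ratfun2 ring" where
  "cluster_algebra b c =
    ring_of_type_algebra
      \<lparr>carrier := generate_ring ring_of_type_algebra (range (cluster_var b c))\<rparr>"

text \<open>
  Requiring a homomorphism to be \<^const>\<open>extensional\<close> makes points that agree on the cluster
  algebra equal as HOL functions.
\<close>

definition points :: "nat \<Rightarrow> nat \<Rightarrow> (ratfun2 \<Rightarrow> 'k::field) set" where
  "points b c =
    ring_hom (cluster_algebra b c) ring_of_type_algebra
      \<inter> extensional (carrier (cluster_algebra b c))"

definition deep_points :: "nat \<Rightarrow> nat \<Rightarrow> (ratfun2 \<Rightarrow> 'k::field) set" where
  "deep_points b c =
    {p \<in> points b c. \<forall>i. p (cluster_var b c i) = 0 \<or> p (cluster_var b c (i + 1)) = 0}"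

definition even_zero_type :: "nat \<Rightarrow> nat \<Rightarrow> (ratfun2 \<Rightarrow> 'k::field) \<Rightarrow> 'k \<Rightarrow> bool" where
  "even_zero_type b c p \<alpha> \<longleftrightarrow>
    (\<forall>i. p (cluster_var b c i) =
      (if even i then 0 else if i mod 4 = 1 then \<alpha> else inverse \<alpha>))"

definition odd_zero_type :: "nat \<Rightarrow> nat \<Rightarrow> (ratfun2 \<Rightarrow> 'k::field) \<Rightarrow> 'k \<Rightarrow> bool" where
  "odd_zero_type b c p \<alpha> \<longleftrightarrow>
    (\<forall>i. p (cluster_var b c i) =
      (if odd i then 0 else if i mod 4 = 2 then \<alpha> else inverse \<alpha>))"

end

theory Submission
  imports
    Defs
    "HOL-Computational_Algebra.Formal_Power_Series"
    "HOL-Computational_Algebra.Polynomial_Factorial"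
begin

text \<open>
  Suppose \<open>p\<close> is deep and \<open>p x\<^sub>r = 0\<close>. The exchange relation at \<open>r\<close> becomes
  \<open>p x\<^sub>r\<^sub>-\<^sub>1 \<cdot> p x\<^sub>r\<^sub>+\<^sub>1 = 1\<close>, so the two neighbours are mutually inverse units, and deepness then kills
  the variables at distance two from \<open>r\<close>. Going on in this way, \<open>p\<close> vanishes on one parity class
  and alternates between \<open>\<alpha>\<close> and \<open>\<alpha>\<^sup>-\<^sup>1\<close> on the other, and the exchange relation at \<open>r + 1\<close> says
  that \<open>\<alpha>\<close> is a root of \<open>-1\<close> of the right order (\<open>alternating_if_deep\<close>). The two types are shifts of
  each other, so both are treated at once, with the parity of \<open>r\<close> as a parameter.

  The exchange relations see nothing of the condition on the characteristic, because at a zero of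
  \<open>x\<^sub>i\<close> the relation \<open>x\<^sub>i x\<^sub>i\<^sub>+\<^sub>2 = x\<^sub>i\<^sub>+\<^sub>1\<^sup>n + 1\<close> does not determine \<open>x\<^sub>i\<^sub>+\<^sub>2\<close>. Multiplying by \<open>x\<^sub>i\<close> and
  cancelling it in the function field gives a relation that does:
  \<open>x\<^sub>i\<^sub>+\<^sub>2 = x\<^sub>i\<^sub>-\<^sub>2 x\<^sub>i\<^sub>+\<^sub>1\<^sup>n - ((1 + x\<^sub>i\<^sup>m)\<^sup>n - 1) / x\<^sub>i\<close>, where \<open>m\<close> and \<open>n\<close> are the exchange exponents
  at \<open>i\<close> and \<open>i + 1\<close> (\<open>cluster_var_skip\<close>). The quotient is a polynomial in \<open>x\<^sub>i\<close> whose value at \<open>0\<close>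
  is \<open>n\<close> if \<open>m = 1\<close> and \<open>0\<close> otherwise. At a deep point with \<open>p x\<^sub>i = 0\<close> every other term vanishes, so
  this value is \<open>0\<close> in the field, which is the stated condition.

  Conversely, a ring homomorphism with the prescribed alternating values has to be produced. It is
  obtained as a limit: substituting formal power series \<open>s\<close>, \<open>t\<close> in a variable \<open>u\<close> for \<open>x\<^sub>1\<close>, \<open>x\<^sub>2\<close> and then
  setting \<open>u = 0\<close> is a homomorphism on every ring of rational functions whose expansions have no
  pole (\<open>limit_point_exists\<close>). The curve \<open>(\<alpha> + u\<^sup>2, u)\<close>, or \<open>(u, \<alpha> + u\<^sup>2)\<close> for the other type, gives
  \<open>x\<^sub>0, x\<^sub>1, x\<^sub>2, x\<^sub>3\<close> the right limits; the polynomial relation above carries regularity and the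
  limits to all other cluster variables (\<open>cluster_expands_of_initial\<close>), and it is satisfied by the
  alternating sequence exactly under the stated condition (\<open>alternating_recursion\<close>).
  A point is determined by its values on the cluster variables, whence uniqueness.
\<close>

section \<open>Polynomial recursions for the cluster variables\<close>

text \<open>
  This is the polynomial \<open>((1 + t\<^sup>m)\<^sup>n - 1) / t\<close> for \<open>m > 0\<close>, written without division so that it can
  be evaluated at \<open>t = 0\<close> and commutes with ring homomorphisms.
\<close>

primrec excess :: "nat \<Rightarrow> nat \<Rightarrow> 'a::comm_ring_1 \<Rightarrow> 'a" where
  "excess m 0 t = 0"
| "excess m (Suc n) t = (1 + t ^ m) * excess m n t + t ^ (m - 1)"

lemma times_excess:
  assumes "m > 0"
  shows "t * excess m n t = (1 + t ^ m) ^ n - 1"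
proof (induction n)
  case (Suc n)
  have "t * excess m (Suc n) t = (1 + t ^ m) * (t * excess m n t) + t ^ m"
    using assms by (cases m) (auto simp: algebra_simps)
  then show ?case by (simp add: Suc algebra_simps)
qed auto

lemma excess_zero:
  assumes "m > 0"
  shows "excess m n 0 = (if m = 1 then of_nat n else 0)"
  using assms by (induction n) (auto simp: power_0_left)

lemma excess_root_of_minus_one:
  assumes "t ^ m = - 1" "n > 0"
  shows "excess m n t = t ^ (m - 1)"
  using assms by (cases n) auto

lemma exchange_exp_skip: "exchange_exp b c (i - 1) = exchange_exp b c (i + 1)"
  by (simp add: exchange_exp_def)

lemma exchange_exp_pos: "b > 0 \<Longrightarrow> c > 0 \<Longrightarrow> exchange_exp b c i > 0"
  by (simp add: exchange_exp_def)

lemma exchange_relation_exp: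
  "cluster_var b c (i - 1) * cluster_var b c (i + 1) = cluster_var b c i ^ exchange_exp b c i + 1"
  using exchange_relation[of b c i] by (simp add: exchange_exp_def)

text \<open>
  Multiplied by \<open>y i\<close>, the term \<open>y (i - 2) * y (i + 1) ^ n\<close> becomes
  \<open>(y (i - 1) ^ n + 1) * y (i + 1) ^ n = (1 + y i ^ m) ^ n + y (i + 1) ^ n\<close>, while
  \<open>y i * y (i + 2) = y (i + 1) ^ n + 1\<close>. The difference is \<open>(1 + y i ^ m) ^ n - 1\<close>, which is divisible
  by \<open>y i\<close>. The second relation is the mirror image of the first under \<open>i + j \<mapsto> i - j\<close>.
\<close>

lemma skip_relation:
  fixes y :: "int \<Rightarrow> 'a::idom"
  assumes rel: "y (i - 2) * y i = y (i - 1) ^ n + 1" "y (i - 1) * y (i + 1) = y i ^ m + 1"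
    "y i * y (i + 2) = y (i + 1) ^ n + 1"
  and "y i \<noteq> 0" "m > 0"
  shows "y (i + 2) = y (i - 2) * y (i + 1) ^ n - excess m n (y i)"
    and "y (i - 2) = y (i + 2) * y (i - 1) ^ n - excess m n (y i)"
proof -
  have pow: "y (i - 1) ^ n * y (i + 1) ^ n = (1 + y i ^ m) ^ n"
    using rel(2) by (simp add: power_mult_distrib[symmetric] add.commute)
  have "y i * (y (i - 2) * y (i + 1) ^ n - excess m n (y i))
      = (y (i - 2) * y i) * y (i + 1) ^ n - y i * excess m n (y i)"
    by (simp add: algebra_simps)
  also have "\<dots> = y i * y (i + 2)"
    using pow by (simp only: rel times_excess[OF \<open>m > 0\<close>]) (simp add: algebra_simps)
  finally show "y (i + 2) = y (i - 2) * y (i + 1) ^ n - excess m n (y i)"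
    using \<open>y i \<noteq> 0\<close> by (metis mult_left_cancel)
  have "y i * (y (i + 2) * y (i - 1) ^ n - excess m n (y i))
      = (y i * y (i + 2)) * y (i - 1) ^ n - y i * excess m n (y i)"
    by (simp add: algebra_simps)
  also have "\<dots> = y i * y (i - 2)"
    using pow by (simp only: rel times_excess[OF \<open>m > 0\<close>] mult.commute[of "y i" "y (i - 2)"])
      (simp add: algebra_simps)
  finally show "y (i - 2) = y (i + 2) * y (i - 1) ^ n - excess m n (y i)"
    using \<open>y i \<noteq> 0\<close> by (metis mult_left_cancel)
qed

lemma cluster_var_skip:
  assumes "b > 0" "c > 0"
  defines "x \<equiv> cluster_var b c" and "e \<equiv> exchange_exp b c"
  shows "x (i + 2) = x (i - 2) * x (i + 1) ^ e (i + 1) - excess (e i) (e (i + 1)) (x i)"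
    and "x (i - 2) = x (i + 2) * x (i - 1) ^ e (i + 1) - excess (e i) (e (i + 1)) (x i)"
proof -
  have "x (i - 2) * x i = x (i - 1) ^ e (i + 1) + 1"
    using exchange_relation_exp[of b c "i - 1"]
    by (simp add: x_def e_def exchange_exp_skip)
  moreover have "x (i - 1) * x (i + 1) = x i ^ e i + 1"
    using exchange_relation_exp[of b c i] by (simp add: x_def e_def)
  moreover have "x i * x (i + 2) = x (i + 1) ^ e (i + 1) + 1"
    using exchange_relation_exp[of b c "i + 1"] by (simp add: x_def e_def add.assoc)
  moreover have "x i \<noteq> 0" using cluster_var_pos[of b c i] by (simp add: x_def)
  moreover have "e i > 0" using assms(1,2) by (simp add: e_def exchange_exp_pos)
  ultimately show "x (i + 2) = x (i - 2) * x (i + 1) ^ e (i + 1) - excess (e i) (e (i + 1)) (x i)"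
    and "x (i - 2) = x (i + 2) * x (i - 1) ^ e (i + 1) - excess (e i) (e (i + 1)) (x i)"
    using skip_relation[of x i "e (i + 1)" "e i"] by blast+
qed

section \<open>Points of the cluster algebra\<close>

lemma ring_of_type_algebra_simps:
  "carrier ring_of_type_algebra = UNIV"
  "x \<oplus>\<^bsub>ring_of_type_algebra\<^esub> y = x + y"
  "x \<otimes>\<^bsub>ring_of_type_algebra\<^esub> y = x * y"
  "\<one>\<^bsub>ring_of_type_algebra\<^esub> = 1"
  "\<zero>\<^bsub>ring_of_type_algebra\<^esub> = 0"
  by (simp_all add: ring_of_type_algebra_def)

lemma a_inv_ring_of_type_algebra:
  fixes x :: "'a::comm_ring_1"
  shows "\<ominus>\<^bsub>ring_of_type_algebra\<^esub> x = - x"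
proof -
  interpret ring "ring_of_type_algebra :: 'a ring" by (rule ring_from_type_algebra)
  show ?thesis
    by (rule minus_equality) (simp_all add: ring_of_type_algebra_simps)
qed

lemma cluster_algebra_simps:
  "x \<oplus>\<^bsub>cluster_algebra b c\<^esub> y = x + y"
  "x \<otimes>\<^bsub>cluster_algebra b c\<^esub> y = x * y"
  "\<one>\<^bsub>cluster_algebra b c\<^esub> = 1"
  by (simp_all add: cluster_algebra_def ring_of_type_algebra_simps)

lemma carrier_cluster_algebra:
  "carrier (cluster_algebra b c) = generate_ring ring_of_type_algebra (range (cluster_var b c))"
  by (simp add: cluster_algebra_def)

lemma cluster_algebra_closed:
  "cluster_var b c i \<in> carrier (cluster_algebra b c)"
  "1 \<in> carrier (cluster_algebra b c)"
  "x \<in> carrier (cluster_algebra b c) \<Longrightarrow> - x \<in> carrier (cluster_algebra b c)"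
  "x \<in> carrier (cluster_algebra b c) \<Longrightarrow> y \<in> carrier (cluster_algebra b c) \<Longrightarrow>
    x + y \<in> carrier (cluster_algebra b c)"
  "x \<in> carrier (cluster_algebra b c) \<Longrightarrow> y \<in> carrier (cluster_algebra b c) \<Longrightarrow>
    x * y \<in> carrier (cluster_algebra b c)"
  unfolding carrier_cluster_algebra
  using generate_ring.intros[where R = ring_of_type_algebra and H = "range (cluster_var b c)"]
  by (auto simp: ring_of_type_algebra_simps a_inv_ring_of_type_algebra)

lemma cluster_algebra_induct [consumes 1, case_names one var minus add mult]:
  assumes "f \<in> carrier (cluster_algebra b c)"
    and "P 1"
    and "\<And>i. P (cluster_var b c i)"
    and "\<And>x. x \<in> carrier (cluster_algebra b c) \<Longrightarrow> P x \<Longrightarrow> P (- x)"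
    and "\<And>x y. x \<in> carrier (cluster_algebra b c) \<Longrightarrow> P x \<Longrightarrow>
      y \<in> carrier (cluster_algebra b c) \<Longrightarrow> P y \<Longrightarrow> P (x + y)"
    and "\<And>x y. x \<in> carrier (cluster_algebra b c) \<Longrightarrow> P x \<Longrightarrow>
      y \<in> carrier (cluster_algebra b c) \<Longrightarrow> P y \<Longrightarrow> P (x * y)"
  shows "P f"
  using assms(1) unfolding carrier_cluster_algebra
proof (induction rule: generate_ring.induct)
  case one
  then show ?case using assms(2) by (simp add: ring_of_type_algebra_simps)
next
  case (incl h)
  then show ?case using assms(3) by auto
next
  case (a_inv h)
  then show ?case
    using assms(4)[of h] by (simp add: a_inv_ring_of_type_algebra carrier_cluster_algebra)
next
  case (eng_add h1 h2)
  then show ?case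
    using assms(5)[of h1 h2] by (simp add: ring_of_type_algebra_simps carrier_cluster_algebra)
next
  case (eng_mult h1 h2)
  then show ?case
    using assms(6)[of h1 h2] by (simp add: ring_of_type_algebra_simps carrier_cluster_algebra)
qed

lemma cluster_algebra_zero: "0 \<in> carrier (cluster_algebra b c)"
  using cluster_algebra_closed(4)[OF cluster_algebra_closed(2) cluster_algebra_closed(3)]
    cluster_algebra_closed(2) by fastforce

lemma cluster_algebra_diff:
  "x \<in> carrier (cluster_algebra b c) \<Longrightarrow> y \<in> carrier (cluster_algebra b c) \<Longrightarrow>
    x - y \<in> carrier (cluster_algebra b c)"
  using cluster_algebra_closed(3,4) by (metis diff_conv_add_uminus)

lemma cluster_algebra_power:
  "x \<in> carrier (cluster_algebra b c) \<Longrightarrow> x ^ n \<in> carrier (cluster_algebra b c)"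
  by (induction n) (auto intro: cluster_algebra_closed)

lemma cluster_algebra_excess:
  "x \<in> carrier (cluster_algebra b c) \<Longrightarrow> excess m n x \<in> carrier (cluster_algebra b c)"
  by (induction n) (auto intro: cluster_algebra_closed cluster_algebra_zero cluster_algebra_power)

context
  fixes b c :: nat and p :: "ratfun2 \<Rightarrow> 'k::field"
  assumes point: "p \<in> points b c"
begin

lemma point_one: "p 1 = 1"
  using point by (simp add: points_def ring_hom_def cluster_algebra_simps ring_of_type_algebra_simps)

lemma point_add:
  "x \<in> carrier (cluster_algebra b c) \<Longrightarrow> y \<in> carrier (cluster_algebra b c) \<Longrightarrow>
    p (x + y) = p x + p y"
  using point by (simp add: points_def ring_hom_def cluster_algebra_simps ring_of_type_algebra_simps)

lemma point_mult:
  "x \<in> carrier (cluster_algebra b c) \<Longrightarrow> y \<in> carrier (cluster_algebra b c) \<Longrightarrow>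
    p (x * y) = p x * p y"
  using point by (simp add: points_def ring_hom_def cluster_algebra_simps ring_of_type_algebra_simps)

lemma point_zero: "p 0 = 0"
  using point_add[OF cluster_algebra_zero cluster_algebra_zero] by (metis add_0 add_right_cancel)

lemma point_minus: "x \<in> carrier (cluster_algebra b c) \<Longrightarrow> p (- x) = - p x"
  using point_add[of x "- x"]
  by (simp add: cluster_algebra_closed point_zero eq_neg_iff_add_eq_0 add.commute)

lemma point_diff:
  "x \<in> carrier (cluster_algebra b c) \<Longrightarrow> y \<in> carrier (cluster_algebra b c) \<Longrightarrow>
    p (x - y) = p x - p y"
  using point_add[of x "- y"] by (simp add: cluster_algebra_closed point_minus)

lemma point_power: "x \<in> carrier (cluster_algebra b c) \<Longrightarrow> p (x ^ n) = p x ^ n"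
  by (induction n) (auto simp: point_one point_mult cluster_algebra_power)

lemma point_excess: "x \<in> carrier (cluster_algebra b c) \<Longrightarrow> p (excess m n x) = excess m n (p x)"
  by (induction n)
    (auto simp: point_one point_mult point_add point_zero point_power cluster_algebra_power
      cluster_algebra_excess cluster_algebra_closed)

lemma point_exchange:
  "p (cluster_var b c (i - 1)) * p (cluster_var b c (i + 1)) =
    p (cluster_var b c i) ^ exchange_exp b c i + 1"
  by (metis exchange_relation_exp point_mult point_add point_power point_one
      cluster_algebra_power cluster_algebra_closed(1,2))

lemma point_skip:
  assumes "b > 0" "c > 0"
  shows "p (cluster_var b c (i + 2)) =
    p (cluster_var b c (i - 2)) * p (cluster_var b c (i + 1)) ^ exchange_exp b c (i + 1) -
    excess (exchange_exp b c i) (exchange_exp b c (i + 1)) (p (cluster_var b c i))"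
  by (subst cluster_var_skip(1)[OF assms])
    (simp add: point_diff point_mult point_power point_excess cluster_algebra_closed
      cluster_algebra_power cluster_algebra_excess)

end

lemma points_eqI:
  assumes p: "p \<in> points b c" and q: "q \<in> points b c"
    and eq: "\<And>i. p (cluster_var b c i) = q (cluster_var b c i)"
  shows "p = q"
proof (rule extensionalityI[of _ "carrier (cluster_algebra b c)"])
  fix f assume "f \<in> carrier (cluster_algebra b c)"
  then show "p f = q f"
    by (induction rule: cluster_algebra_induct)
      (simp_all add: eq point_one[OF p] point_one[OF q] point_minus[OF p] point_minus[OF q]
        point_add[OF p] point_add[OF q] point_mult[OF p] point_mult[OF q])
qed (use p q in \<open>auto simp: points_def\<close>)

section \<open>Limits along a formal curve\<close>

text \<open>
  Integer coefficients are essential: rational polynomials cannot be evaluated in a field of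
  positive characteristic.
\<close>

definition eval2 :: "'a::comm_ring_1 \<Rightarrow> 'a \<Rightarrow> int poly poly \<Rightarrow> 'a" where
  "eval2 s t P = poly (map_poly (\<lambda>q. poly (map_poly of_int q) s) P) t"

lemma poly_map_poly_hom:
  fixes h :: "'a::comm_ring_1 \<Rightarrow> 'b::comm_ring_1"
  assumes add: "\<And>u v. h (u + v) = h u + h v" and mult: "\<And>u v. h (u * v) = h u * h v"
    and zero: "h 0 = 0"
  shows "poly (map_poly h (P + Q)) t = poly (map_poly h P) t + poly (map_poly h Q) t"
    and "poly (map_poly h (P * Q)) t = poly (map_poly h P) t * poly (map_poly h Q) t"
proof -
  have A: "poly (map_poly h (P + Q)) t = poly (map_poly h P) t + poly (map_poly h Q) t" for P Q
    by (induction P Q rule: poly_induct2)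
      (simp_all add: map_poly_pCons zero add algebra_simps)
  have S: "poly (map_poly h (smult a Q)) t = h a * poly (map_poly h Q) t" for a Q
    by (induction Q) (simp_all add: map_poly_pCons zero mult algebra_simps)
  show "poly (map_poly h (P + Q)) t = poly (map_poly h P) t + poly (map_poly h Q) t"
    by (rule A)
  show "poly (map_poly h (P * Q)) t = poly (map_poly h P) t * poly (map_poly h Q) t"
    by (induction P) (simp_all add: map_poly_pCons zero A S algebra_simps)
qed

lemma poly_of_int_hom:
  fixes s :: "'a::comm_ring_1"
  shows "poly (map_poly of_int (u + v)) s = poly (map_poly of_int u) s + poly (map_poly of_int v) s"
    and "poly (map_poly of_int (u * v)) s = poly (map_poly of_int u) s * poly (map_poly of_int v) s"
  by (rule poly_map_poly_hom; simp)+

lemma eval2_add: "eval2 s t (P + Q) = eval2 s t P + eval2 s t Q"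
  unfolding eval2_def by (rule poly_map_poly_hom) (simp_all add: poly_of_int_hom)

lemma eval2_mult: "eval2 s t (P * Q) = eval2 s t P * eval2 s t Q"
  unfolding eval2_def by (rule poly_map_poly_hom) (simp_all add: poly_of_int_hom)

lemma eval2_pCons:
  "eval2 s t (pCons q P) = poly (map_poly of_int q) s + t * eval2 s t P"
  unfolding eval2_def by (simp add: map_poly_pCons)

lemma eval2_0: "eval2 s t 0 = 0"
  by (simp add: eval2_def)

lemma eval2_1: "eval2 s t 1 = 1"
  using eval2_pCons[of s t 1 0] by (simp add: eval2_0 one_pCons map_poly_pCons)

lemma eval2_minus: "eval2 s t (- P) = - eval2 s t P"
  using eval2_add[of s t P "- P"] by (simp add: eval2_0 eq_neg_iff_add_eq_0 add.commute)

lemma eval2_X: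
  "eval2 s t [:[:0, 1:]:] = s" "eval2 s t [:0, 1:] = t"
  by (simp_all add: eval2_pCons eval2_0 map_poly_pCons)

lemma to_fract_of_int: "to_fract (of_int a) = of_int a"
proof -
  have *: "to_fract (of_nat n) = of_nat n" for n by (induction n) simp_all
  show ?thesis by (cases a rule: int_diff_cases) (simp add: *)
qed

text \<open>
  This is the algebraic independence of \<open>X1\<close> and \<open>X2\<close> over \<open>\<int>\<close>: evaluation at them is the
  composition of the inclusions of \<open>\<int>[x\<^sub>1][x\<^sub>2]\<close> into \<open>\<rat>[x\<^sub>1][x\<^sub>2]\<close> and its fraction field. It makes the
  substitution of other elements for \<open>X1\<close> and \<open>X2\<close> well defined.
\<close>

lemma eval2_generic_eq_0_iff: "eval2 X1 X2 P = 0 \<longleftrightarrow> P = 0"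
proof -
  have X: "to_fract [:[:0, 1:]:] = X1" "to_fract [:0, 1:] = X2"
    by (simp_all add: X1_def X2_def to_fract_def)
  have inner: "poly (map_poly of_int q) X1 = to_fract [:map_poly of_int q:]" for q
  proof (induction q)
    case (pCons a q)
    have "of_int a = (to_fract [:[:of_int a:]:] :: ratfun2)"
      by (simp only: of_int_poly[symmetric] to_fract_of_int)
    then have "poly (map_poly of_int (pCons a q)) X1 =
        to_fract ([:[:of_int a:]:] + [:[:0, 1:]:] * [:map_poly of_int q:])"
      by (simp only: map_poly_pCons of_int_0 poly_pCons pCons to_fract_add to_fract_mult X)
    also have "[:[:of_int a:]:] + [:[:0, 1:]:] * [:map_poly of_int q:] =
        ([:map_poly of_int (pCons a q):] :: rat poly poly)"
      by (simp add: map_poly_pCons)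
    finally show ?case .
  qed simp
  have "eval2 X1 X2 P = to_fract (map_poly (map_poly of_int) P)"
  proof (induction P)
    case (pCons q P)
    have "eval2 X1 X2 (pCons q P) =
        to_fract ([:map_poly of_int q:] + [:0, 1:] * map_poly (map_poly of_int) P)"
      by (simp only: eval2_pCons inner pCons to_fract_add to_fract_mult X)
    then show ?case by (simp add: map_poly_pCons)
  qed (simp add: eval2_0)
  then have "eval2 X1 X2 P = 0 \<longleftrightarrow> map_poly (map_poly of_int) P = (0 :: rat poly poly)"
    by simp
  also have "\<dots> \<longleftrightarrow> P = 0"
    by (subst map_poly_eq_0_iff) (auto simp: map_poly_eq_0_iff)
  finally show ?thesis .
qed

text \<open>
  Here \<open>f\<close> is a rational function \<open>P / M\<close>, and \<open>F\<close> is the power series that results from substituting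
  \<open>s\<close> and \<open>t\<close> for \<open>X1\<close> and \<open>X2\<close>. A relation is used instead of a partial function because the
  substitution makes sense only if the denominator survives it and the quotient has no pole. The
  value of \<open>f\<close> at the limit point of the curve is the constant coefficient of \<open>F\<close>.
\<close>

definition expands :: "'k::field fps \<Rightarrow> 'k fps \<Rightarrow> ratfun2 \<Rightarrow> 'k fps \<Rightarrow> bool" where
  "expands s t f F \<longleftrightarrow> (\<exists>M P. eval2 s t M \<noteq> 0 \<and>
    eval2 X1 X2 M * f = eval2 X1 X2 P \<and> eval2 s t M * F = eval2 s t P)"

lemma expandsI:
  "eval2 s t M \<noteq> 0 \<Longrightarrow> eval2 X1 X2 M * f = eval2 X1 X2 P \<Longrightarrow>
    eval2 s t M * F = eval2 s t P \<Longrightarrow> expands s t f F"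
  unfolding expands_def by blast

lemma expands_1: "expands s t 1 1"
  by (rule expandsI[of _ _ 1 _ 1]) (simp_all add: eval2_1)

lemma expands_X: "expands s t X1 s" "expands s t X2 t"
  by (rule expandsI[of _ _ 1 _ "[:[:0, 1:]:]"]; simp add: eval2_1 eval2_X)
    (rule expandsI[of _ _ 1 _ "[:0, 1:]"]; simp add: eval2_1 eval2_X)

lemma expands_minus:
  assumes "expands s t f F"
  shows "expands s t (- f) (- F)"
proof -
  obtain M P where "eval2 s t M \<noteq> 0" "eval2 X1 X2 M * f = eval2 X1 X2 P"
    "eval2 s t M * F = eval2 s t P"
    using assms unfolding expands_def by blast
  then show ?thesis
    by (intro expandsI[of _ _ M _ "- P"]) (simp_all add: eval2_minus)
qed

lemma expands_add:
  assumes "expands s t f F" "expands s t g G"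
  shows "expands s t (f + g) (F + G)"
proof -
  obtain M P where f: "eval2 s t M \<noteq> 0" "eval2 X1 X2 M * f = eval2 X1 X2 P"
    "eval2 s t M * F = eval2 s t P"
    using assms unfolding expands_def by blast
  obtain N Q where g: "eval2 s t N \<noteq> 0" "eval2 X1 X2 N * g = eval2 X1 X2 Q"
    "eval2 s t N * G = eval2 s t Q"
    using assms unfolding expands_def by blast
  show ?thesis
    by (rule expandsI[of _ _ "M * N" _ "P * N + Q * M"])
      (use f(1) g(1) in \<open>simp_all add: eval2_add eval2_mult f(2,3)[symmetric] g(2,3)[symmetric]
        algebra_simps\<close>)
qed

lemma expands_mult:
  assumes "expands s t f F" "expands s t g G"
  shows "expands s t (f * g) (F * G)"
proof -
  obtain M P where f: "eval2 s t M \<noteq> 0" "eval2 X1 X2 M * f = eval2 X1 X2 P"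
    "eval2 s t M * F = eval2 s t P"
    using assms unfolding expands_def by blast
  obtain N Q where g: "eval2 s t N \<noteq> 0" "eval2 X1 X2 N * g = eval2 X1 X2 Q"
    "eval2 s t N * G = eval2 s t Q"
    using assms unfolding expands_def by blast
  show ?thesis
    by (rule expandsI[of _ _ "M * N" _ "P * Q"])
      (use f(1) g(1) in \<open>simp_all add: eval2_mult f(2,3)[symmetric] g(2,3)[symmetric]\<close>)
qed

text \<open>
  The condition \<open>G * H = F\<close> allows \<open>G\<close> to vanish at the limit point as long as \<open>F\<close> vanishes there to
  at least the same order. This is how variables with a denominator that tends to \<open>0\<close> get a limit.
\<close>

lemma expands_divide:
  assumes "expands s t f F" "expands s t g G" "G \<noteq> 0" "G * H = F"
  shows "expands s t (f / g) H"
proof -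
  obtain M P where f: "eval2 s t M \<noteq> 0" "eval2 X1 X2 M * f = eval2 X1 X2 P"
    "eval2 s t M * F = eval2 s t P"
    using assms unfolding expands_def by blast
  obtain N Q where g: "eval2 s t N \<noteq> 0" "eval2 X1 X2 N * g = eval2 X1 X2 Q"
    "eval2 s t N * G = eval2 s t Q"
    using assms unfolding expands_def by blast
  have Q: "eval2 s t Q \<noteq> 0" using g(1,3) assms(3) by (metis mult_eq_0_iff)
  then have "Q \<noteq> 0" by (auto simp: eval2_0)
  then have "g \<noteq> 0" using g(2) eval2_generic_eq_0_iff[of Q] by auto
  show ?thesis
  proof (rule expandsI[of _ _ "M * Q" _ "P * N"])
    show "eval2 s t (M * Q) \<noteq> 0" using f(1) Q by (simp add: eval2_mult)
    show "eval2 X1 X2 (M * Q) * (f / g) = eval2 X1 X2 (P * N)"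
      using \<open>g \<noteq> 0\<close> by (simp add: eval2_mult f(2)[symmetric] g(2)[symmetric])
    show "eval2 s t (M * Q) * H = eval2 s t (P * N)"
      by (simp add: eval2_mult f(3)[symmetric] g(3)[symmetric] assms(4)[symmetric])
  qed
qed

lemma expands_diff:
  "expands s t f F \<Longrightarrow> expands s t g G \<Longrightarrow> expands s t (f - g) (F - G)"
  using expands_add[of s t f F "- g" "- G"] expands_minus[of s t g G] by simp

lemma expands_0: "expands s t 0 0"
  using expands_diff[OF expands_1 expands_1] by simp

lemma expands_power: "expands s t f F \<Longrightarrow> expands s t (f ^ n) (F ^ n)"
  by (induction n) (auto intro: expands_1 expands_mult)

lemma expands_excess: "expands s t f F \<Longrightarrow> expands s t (excess m n f) (excess m n F)"
  by (induction n) (auto intro: expands_0 expands_1 expands_mult expands_add expands_power)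

text \<open>
  By subtraction it suffices that \<open>0\<close> expands only to \<open>0\<close>, and a numerator of \<open>0\<close> is the zero
  polynomial by the independence of \<open>X1\<close> and \<open>X2\<close>.
\<close>

lemma expands_unique:
  assumes "expands s t f F" "expands s t f G"
  shows "F = G"
proof -
  obtain M P where *: "eval2 s t M \<noteq> 0" "eval2 X1 X2 M * (f - f) = eval2 X1 X2 P"
    "eval2 s t M * (F - G) = eval2 s t P"
    using expands_diff[OF assms] unfolding expands_def by blast
  have "P = 0" using *(2) eval2_generic_eq_0_iff[of P] by simp
  then show ?thesis using *(1,3) by (simp add: eval2_0)
qed

text \<open>
  Expansion along the curve is a ring homomorphism on its domain, which contains the cluster algebra
  as soon as it contains the cluster variables. The point is its composition with \<open>u \<mapsto> 0\<close>.
\<close>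

lemma limit_point_exists:
  fixes s t :: "'k::field fps"
  assumes var: "\<And>i. \<exists>F. expands s t (cluster_var b c i) F \<and> fps_nth F 0 = v i"
  shows "\<exists>p \<in> points b c. \<forall>i. p (cluster_var b c i) = v i"
proof -
  define A where "A = carrier (cluster_algebra b c)"
  define p where "p = restrict (\<lambda>f. fps_nth (THE F. expands s t f F) 0) A"
  have ex: "\<exists>F. expands s t f F" if "f \<in> A" for f
    using that unfolding A_def
  proof (induction rule: cluster_algebra_induct)
    case (var i)
    then show ?case using assms by blast
  qed (blast intro: expands_1 expands_minus expands_add expands_mult)+
  have val: "p f = fps_nth F 0" if "f \<in> A" "expands s t f F" for f F
  proof -
    have "(THE F. expands s t f F) = F" using that(2) expands_unique by blast
    then show ?thesis using that(1) by (simp add: p_def)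
  qed
  have "p (f + g) = p f + p g \<and> p (f * g) = p f * p g" if fg: "f \<in> A" "g \<in> A" for f g
  proof -
    obtain F G where FG: "expands s t f F" "expands s t g G" using ex fg by blast
    have "p (f + g) = fps_nth (F + G) 0"
      using fg FG by (intro val expands_add) (auto simp: A_def cluster_algebra_closed)
    moreover have "p (f * g) = fps_nth (F * G) 0"
      using fg FG by (intro val expands_mult) (auto simp: A_def cluster_algebra_closed)
    ultimately show ?thesis using val[OF fg(1) FG(1)] val[OF fg(2) FG(2)] by simp
  qed
  moreover have "p 1 = 1"
    using val[OF _ expands_1] by (simp add: A_def cluster_algebra_closed)
  ultimately have "p \<in> points b c"
    unfolding points_def ring_hom_def
    by (auto simp: cluster_algebra_simps ring_of_type_algebra_simps A_def[symmetric])
      (simp add: p_def)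
  moreover have "p (cluster_var b c i) = v i" for i
    using var[of i] val[of "cluster_var b c i"] cluster_algebra_closed(1)[of b c i]
    by (auto simp: A_def)
  ultimately show ?thesis by blast
qed

text \<open>
  Four consecutive variables determine all the others polynomially, in both directions. The limits
  \<open>v i\<close> therefore propagate from indices \<open>0\<close> to \<open>3\<close> if \<open>v\<close> satisfies the same polynomial recursions.
  The exchange relations alone would not do: they may require division by variables with limit \<open>0\<close>.
\<close>

lemma cluster_expands_of_initial:
  fixes s t :: "'k::field fps" and v :: "int \<Rightarrow> 'k"
  assumes "b > 0" "c > 0"
  defines "e \<equiv> exchange_exp b c"
  assumes up: "\<And>i. v (i + 2) = v (i - 2) * v (i + 1) ^ e (i + 1) - excess (e i) (e (i + 1)) (v i)"
    and down: "\<And>i. v (i - 2) = v (i + 2) * v (i - 1) ^ e (i + 1) - excess (e i) (e (i + 1)) (v i)"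
    and init: "\<And>i. i \<in> {0, 1, 2, 3} \<Longrightarrow> \<exists>F. expands s t (cluster_var b c i) F \<and> fps_nth F 0 = v i"
  shows "\<exists>F. expands s t (cluster_var b c i) F \<and> fps_nth F 0 = v i"
proof -
  define E where "E i \<longleftrightarrow> (\<exists>F. expands s t (cluster_var b c i) F \<and> fps_nth F 0 = v i)" for i
  have excess_nth: "fps_nth (excess m n F) 0 = excess m n (fps_nth F 0)" for m n and F :: "'k fps"
    by (induction n) (simp_all add: fps_power_zeroth)
  have E_up: "E (i + 2)" if "E (i - 2)" "E i" "E (i + 1)" for i
  proof -
    obtain F G H where "expands s t (cluster_var b c (i - 2)) F" "fps_nth F 0 = v (i - 2)"
      "expands s t (cluster_var b c i) G" "fps_nth G 0 = v i"
      "expands s t (cluster_var b c (i + 1)) H" "fps_nth H 0 = v (i + 1)"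
      using \<open>E (i - 2)\<close> \<open>E i\<close> \<open>E (i + 1)\<close> unfolding E_def by blast
    then have "expands s t (cluster_var b c (i + 2)) (F * H ^ e (i + 1) - excess (e i) (e (i + 1)) G)"
      "fps_nth (F * H ^ e (i + 1) - excess (e i) (e (i + 1)) G) 0 = v (i + 2)"
      unfolding cluster_var_skip(1)[OF assms(1,2), of i] up[of i] e_def
      by (auto intro!: expands_diff expands_mult expands_power expands_excess
          simp: excess_nth fps_power_zeroth)
    then show ?thesis unfolding E_def by blast
  qed
  have E_down: "E (i - 2)" if "E (i + 2)" "E i" "E (i - 1)" for i
  proof -
    obtain F G H where "expands s t (cluster_var b c (i + 2)) F" "fps_nth F 0 = v (i + 2)"
      "expands s t (cluster_var b c i) G" "fps_nth G 0 = v i"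
      "expands s t (cluster_var b c (i - 1)) H" "fps_nth H 0 = v (i - 1)"
      using \<open>E (i + 2)\<close> \<open>E i\<close> \<open>E (i - 1)\<close> unfolding E_def by blast
    then have "expands s t (cluster_var b c (i - 2)) (F * H ^ e (i + 1) - excess (e i) (e (i + 1)) G)"
      "fps_nth (F * H ^ e (i + 1) - excess (e i) (e (i + 1)) G) 0 = v (i - 2)"
      unfolding cluster_var_skip(2)[OF assms(1,2), of i] down[of i] e_def
      by (auto intro!: expands_diff expands_mult expands_power expands_excess
          simp: excess_nth fps_power_zeroth)
    then show ?thesis unfolding E_def by blast
  qed
  have "E i \<and> E (i + 1) \<and> E (i + 2) \<and> E (i + 3)"
  proof (induction i rule: int_induct[where k = 0])
    case base
    then show ?case using init unfolding E_def by simp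
  next
    case (step1 i)
    then show ?case using E_up[of "i + 2"] by (simp add: add.assoc)
  next
    case (step2 i)
    then show ?case using E_down[of "i + 1"] by (simp add: algebra_simps)
  qed
  then show ?thesis unfolding E_def by blast
qed

section \<open>Alternating sequences\<close>

text \<open>
  The values of a point of the first type; those of the second type are the same sequence shifted
  by one.
\<close>

definition alternating :: "'k::field \<Rightarrow> int \<Rightarrow> 'k" where
  "alternating \<alpha> i = (if even i then 0 else if i mod 4 = 1 then \<alpha> else inverse \<alpha>)"

lemma even_zero_type_iff:
  "even_zero_type b c p \<alpha> \<longleftrightarrow> (\<forall>i. p (cluster_var b c i) = alternating \<alpha> (i - 0))"
  by (simp add: even_zero_type_def alternating_def)

lemma odd_zero_type_iff:
  "odd_zero_type b c p \<alpha> \<longleftrightarrow> (\<forall>i. p (cluster_var b c i) = alternating \<alpha> (i - 1))"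
proof -
  have "(i - 1) mod 4 = 1 \<longleftrightarrow> i mod 4 = 2" for i :: int by presburger
  then show ?thesis by (simp add: odd_zero_type_def alternating_def)
qed

lemma alternating_skip:
  assumes "odd i"
  shows "alternating \<alpha> (i + 2) = inverse (alternating \<alpha> i)"
    and "alternating \<alpha> (i - 2) = inverse (alternating \<alpha> i)"
proof -
  have *: "(i + 2) mod 4 = 1 \<longleftrightarrow> i mod 4 \<noteq> 1" "(i - 2) mod 4 = 1 \<longleftrightarrow> i mod 4 \<noteq> 1"
    using assms by presburger+
  show "alternating \<alpha> (i + 2) = inverse (alternating \<alpha> i)"
    "alternating \<alpha> (i - 2) = inverse (alternating \<alpha> i)"
    using assms by (auto simp: alternating_def *)
qed

text \<open>
  At indices where the sequence vanishes, the recursions reduce to the hypothesis on \<open>excess\<close>. At the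
  other indices the product term vanishes and \<open>v i\<close> is an \<open>e i\<close>-th root of \<open>-1\<close>, so
  that the excess is \<open>v i ^ (e i - 1) = - inverse (v i)\<close>.
\<close>

lemma alternating_recursion:
  fixes \<alpha> :: "'k::field"
  assumes "b > 0" "c > 0"
  defines "e \<equiv> exchange_exp b c"
  assumes \<alpha>: "\<alpha> \<noteq> 0" "\<alpha> ^ e (r + 1) = - 1" and zero: "excess (e r) (e (r + 1)) (0 :: 'k) = 0"
  defines "v \<equiv> \<lambda>i. alternating \<alpha> (i - r)"
  shows "v (i + 2) = v (i - 2) * v (i + 1) ^ e (i + 1) - excess (e i) (e (i + 1)) (v i)"
    and "v (i - 2) = v (i + 2) * v (i - 1) ^ e (i + 1) - excess (e i) (e (i + 1)) (v i)"
proof -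
  have pos: "e j > 0" for j using assms(1,2) by (simp add: e_def exchange_exp_pos)
  have "v (i + 2) = v (i - 2) * v (i + 1) ^ e (i + 1) - excess (e i) (e (i + 1)) (v i) \<and>
    v (i - 2) = v (i + 2) * v (i - 1) ^ e (i + 1) - excess (e i) (e (i + 1)) (v i)"
  proof (cases "even (i - r)")
    case True
    then have "e i = e r" "e (i + 1) = e (r + 1)" by (auto simp: e_def exchange_exp_def)
    moreover have "v i = 0" "v (i + 2) = 0" "v (i - 2) = 0"
      using True by (auto simp: v_def alternating_def)
    ultimately show ?thesis using zero by simp
  next
    case False
    then have e: "e i = e (r + 1)" by (auto simp: e_def exchange_exp_def)
    have z: "v (i + 1) = 0" "v (i - 1) = 0"
      using False by (auto simp: v_def alternating_def)
    have "v i = \<alpha> \<or> v i = inverse \<alpha>" using False by (auto simp: v_def alternating_def)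
    moreover have "inverse \<alpha> ^ e (r + 1) = - 1"
      using \<alpha>(2) by (simp only: power_inverse inverse_minus_eq inverse_1)
    ultimately have root: "v i ^ e i = - 1"
      using \<alpha>(2) e by auto
    have "v i * v i ^ (e i - 1) = v i ^ e i"
      using pos[of i] by (metis power_eq_if neq0_conv)
    then have "v i * (- (v i ^ (e i - 1))) = 1" by (simp only: root mult_minus_right minus_minus)
    then have inv: "inverse (v i) = - (v i ^ (e i - 1))" by (rule inverse_unique)
    have "v (i + 2) = inverse (v i)" "v (i - 2) = inverse (v i)"
      using alternating_skip[of "i - r" \<alpha>] False by (simp_all add: v_def algebra_simps)
    then show ?thesis
      unfolding z inv excess_root_of_minus_one[OF root pos] using pos[of "i + 1"] by simp
  qed
  then show "v (i + 2) = v (i - 2) * v (i + 1) ^ e (i + 1) - excess (e i) (e (i + 1)) (v i)"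
    and "v (i - 2) = v (i + 2) * v (i - 1) ^ e (i + 1) - excess (e i) (e (i + 1)) (v i)"
    by blast+
qed

text \<open>
  A zero at \<open>j\<close> makes \<open>v (j - 1)\<close> and \<open>v (j + 1)\<close> mutually inverse, hence nonzero, and so forces zeros
  at \<open>j - 2\<close> and \<open>j + 2\<close>. Induction in both directions along the two parity classes gives the claim.
\<close>

lemma alternating_if_deep:
  fixes v :: "int \<Rightarrow> 'k::field"
  assumes ex: "\<And>i. v (i - 1) * v (i + 1) = v i ^ e i + 1"
    and pos: "\<And>i. e i > 0"
    and deep: "\<And>i. v i = 0 \<or> v (i + 1) = 0"
    and "v r = 0"
  shows "\<exists>\<alpha>. \<alpha> \<noteq> 0 \<and> \<alpha> ^ e (r + 1) = - 1 \<and> (\<forall>i. v i = alternating \<alpha> (i - r))"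
proof -
  have unit: "v (j - 1) * v (j + 1) = 1" if "v j = 0" for j
    using ex[of j] that pos[of j] by simp
  have skip: "v (j + 2) = 0 \<and> v (j - 2) = 0" if "v j = 0" for j
    using unit[OF that] deep[of "j + 1"] deep[of "j - 2"] by (auto simp: algebra_simps)
  have zero: "v (r + 2 * n) = 0" for n
  proof (induction n rule: int_induct[where k = 0])
    case base
    then show ?case using \<open>v r = 0\<close> by simp
  next
    case (step1 n)
    then show ?case using skip[of "r + 2 * n"] by (simp add: algebra_simps)
  next
    case (step2 n)
    then show ?case using skip[of "r + 2 * n"] by (simp add: algebra_simps)
  qed
  define \<alpha> where "\<alpha> = v (r + 1)"
  have "\<alpha> \<noteq> 0" using unit[of r] \<open>v r = 0\<close> by (auto simp: \<alpha>_def)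
  have next_odd: "v (r + 1 + 2 * n) = inverse (v (r + 1 + 2 * (n - 1)))" for n
    using unit[OF zero[of n]]
    by (intro inverse_unique[symmetric]) (simp add: algebra_simps)
  have odd: "v (r + 1 + 2 * n) = (if even n then \<alpha> else inverse \<alpha>)" for n
  proof (induction n rule: int_induct[where k = 0])
    case base
    then show ?case by (simp add: \<alpha>_def)
  next
    case (step1 n)
    then show ?case using next_odd[of "n + 1"] by simp
  next
    case (step2 n)
    have "v (r + 1 + 2 * (n - 1)) = inverse (v (r + 1 + 2 * n))"
      using next_odd[of n] by simp
    then show ?case using step2 by simp
  qed
  have "v i = alternating \<alpha> (i - r)" for i
  proof (cases "even (i - r)")
    case True
    then obtain n where "i - r = 2 * n" by blast
    then have "i = r + 2 * n" by simp
    then show ?thesis using zero[of n] by (simp add: alternating_def)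
  next
    case False
    then obtain n where "i - r = 2 * n + 1" by (elim oddE)
    then have i: "i = r + 1 + 2 * n" by simp
    have "(2 * n + 1) mod 4 = 1 \<longleftrightarrow> even n" by presburger
    then show ?thesis using odd[of n] unfolding i by (simp add: alternating_def algebra_simps)
  qed
  moreover have "\<alpha> ^ e (r + 1) = - 1"
    using ex[of "r + 1"] \<open>v r = 0\<close> by (simp add: \<alpha>_def eq_neg_iff_add_eq_0)
  ultimately show ?thesis using \<open>\<alpha> \<noteq> 0\<close> by blast
qed

section \<open>Deep points\<close>

text \<open>
  The square in \<open>\<alpha> + u\<^sup>2\<close> is what makes the quotient by \<open>u\<close> vanish at \<open>u = 0\<close>: modulo \<open>u\<^sup>2\<close> the series
  is still a root of \<open>-1\<close>. With \<open>\<alpha> + u\<close> the quotient would tend to \<open>n \<alpha>\<^sup>n\<^sup>-\<^sup>1\<close>.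
\<close>

lemma power_at_perturbed_root:
  fixes \<alpha> :: "'k::field"
  assumes "\<alpha> ^ n = - 1"
  shows "\<exists>F. fps_X * F = (fps_const \<alpha> + fps_X\<^sup>2) ^ n + 1 \<and> fps_nth F 0 = 0"
proof -
  have "fps_X\<^sup>2 dvd (fps_const \<alpha> + fps_X\<^sup>2) ^ n - fps_const \<alpha> ^ n"
    using power_diff_sumr2[of "fps_const \<alpha> + fps_X\<^sup>2" n "fps_const \<alpha>"] by simp
  also have "fps_const \<alpha> ^ n = - 1"
    using assms by (metis fps_const_1_eq_1 fps_const_neg fps_const_power)
  finally obtain F where "(fps_const \<alpha> + fps_X\<^sup>2) ^ n + 1 = fps_X\<^sup>2 * F"
    by (auto elim!: dvdE)
  then have "fps_X * (fps_X * F) = (fps_const \<alpha> + fps_X\<^sup>2) ^ n + 1"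
    by (simp add: power2_eq_square mult.assoc)
  then show ?thesis by (intro exI[of _ "fps_X * F"]) simp
qed

lemma fps_divide_nth_0:
  fixes F G :: "'k::field fps"
  assumes "fps_nth G 0 \<noteq> 0"
  shows "\<exists>H. G * H = F \<and> fps_nth H 0 = fps_nth F 0 / fps_nth G 0"
  using assms inverse_mult_eq_1'[of G]
  by (intro exI[of _ "F * inverse G"]) (simp add: mult.left_commute field_simps)

lemma cluster_var_initial:
  "cluster_var b c 0 = (X1 ^ b + 1) / X2" "cluster_var b c 1 = X1" "cluster_var b c 2 = X2"
  "cluster_var b c 3 = (X2 ^ c + 1) / X1"
proof -
  show x: "cluster_var b c 1 = X1" "cluster_var b c 2 = X2"
    by (subst cluster_var.simps; simp)+
  show "cluster_var b c 0 = (X1 ^ b + 1) / X2" "cluster_var b c 3 = (X2 ^ c + 1) / X1"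
    by (subst cluster_var.simps; simp add: x exchange_exp_def)+
qed

text \<open>
  The case \<open>r = 0\<close> is the first type and \<open>r = 1\<close> the second. In each, one of \<open>x\<^sub>1\<close>, \<open>x\<^sub>2\<close> tends to \<open>\<alpha>\<close>
  and the other to \<open>0\<close>. Of the outer variables \<open>x\<^sub>0 = (x\<^sub>1\<^sup>b + 1) / x\<^sub>2\<close> and \<open>x\<^sub>3 = (x\<^sub>2\<^sup>c + 1) / x\<^sub>1\<close>, one is
  of the form \<open>0 / 0\<close> in the limit and needs the special curve; the other simply tends to \<open>1 / \<alpha>\<close>.
\<close>

lemma deep_point_exists:
  fixes \<alpha> :: "'k::field"
  assumes "b > 0" "c > 0"
  defines "e \<equiv> exchange_exp b c"
  assumes r: "r \<in> {0, 1}" and \<alpha>: "\<alpha> \<noteq> 0" "\<alpha> ^ e (r + 1) = - 1"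
    and zero: "excess (e r) (e (r + 1)) (0 :: 'k) = 0"
  shows "\<exists>!p. p \<in> deep_points b c \<and> (\<forall>i. p (cluster_var b c i) = alternating \<alpha> (i - r))"
proof -
  define w where "w = fps_const \<alpha> + fps_X\<^sup>2"
  have w: "fps_nth w 0 = \<alpha>" by (simp add: w_def)
  then have "w \<noteq> 0" using \<alpha>(1) by auto
  define s t where "s = (if r = 0 then w else fps_X)" and "t = (if r = 0 then fps_X else w)"
  have st: "s \<noteq> 0" "t \<noteq> 0" using \<open>w \<noteq> 0\<close> by (auto simp: s_def t_def)
  have "\<exists>F. t * F = s ^ b + 1 \<and> fps_nth F 0 = alternating \<alpha> (0 - r)"
  proof (cases "r = 0")
    case True
    then show ?thesis
      using power_at_perturbed_root[of \<alpha> b] \<alpha>(2)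
      by (simp add: s_def t_def w_def alternating_def e_def exchange_exp_def)
  next
    case False
    then show ?thesis
      using fps_divide_nth_0[of w "fps_X ^ b + 1"] w \<alpha>(1) r \<open>b > 0\<close>
      by (simp add: s_def t_def alternating_def fps_power_zeroth divide_inverse power_0_left)
  qed
  then obtain F0 where F0: "t * F0 = s ^ b + 1" "fps_nth F0 0 = alternating \<alpha> (0 - r)" by blast
  have "\<exists>F. s * F = t ^ c + 1 \<and> fps_nth F 0 = alternating \<alpha> (3 - r)"
  proof (cases "r = 0")
    case True
    then show ?thesis
      using fps_divide_nth_0[of w "fps_X ^ c + 1"] w \<alpha>(1) \<open>c > 0\<close>
      by (simp add: s_def t_def alternating_def fps_power_zeroth divide_inverse power_0_left)
  next
    case False
    then show ?thesis
      using power_at_perturbed_root[of \<alpha> c] \<alpha>(2) r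
      by (simp add: s_def t_def w_def alternating_def e_def exchange_exp_def)
  qed
  then obtain F3 where F3: "s * F3 = t ^ c + 1" "fps_nth F3 0 = alternating \<alpha> (3 - r)" by blast
  have x0: "expands s t (cluster_var b c 0) F0"
    unfolding cluster_var_initial
    by (rule expands_divide[OF expands_add[OF expands_power[OF expands_X(1)] expands_1]
          expands_X(2) st(2) F0(1)])
  have x3: "expands s t (cluster_var b c 3) F3"
    unfolding cluster_var_initial
    by (rule expands_divide[OF expands_add[OF expands_power[OF expands_X(2)] expands_1]
          expands_X(1) st(1) F3(1)])
  have "\<exists>F. expands s t (cluster_var b c i) F \<and> fps_nth F 0 = alternating \<alpha> (i - r)"
    if "i \<in> {0, 1, 2, 3}" for i
  proof -
    have "fps_nth s 0 = alternating \<alpha> (1 - r)" "fps_nth t 0 = alternating \<alpha> (2 - r)"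
      using w r by (auto simp: s_def t_def alternating_def)
    then show ?thesis
      using that x0 x3 F0(2) F3(2) expands_X[of s t] cluster_var_initial(2,3)[of b c] by auto
  qed
  then have "\<exists>F. expands s t (cluster_var b c i) F \<and> fps_nth F 0 = alternating \<alpha> (i - r)" for i
    using cluster_expands_of_initial[OF assms(1,2), of "\<lambda>i. alternating \<alpha> (i - r)" s t]
      alternating_recursion[OF assms(1,2) \<alpha>(1), of r] \<alpha>(2) zero
    unfolding e_def by blast
  then obtain p :: "ratfun2 \<Rightarrow> 'k" where p: "p \<in> points b c"
    "\<And>i. p (cluster_var b c i) = alternating \<alpha> (i - r)"
    using limit_point_exists[of s t b c "\<lambda>i. alternating \<alpha> (i - r)"] by blast
  show ?thesis
  proof (rule ex1I[of _ p])
    show "p \<in> deep_points b c \<and> (\<forall>i. p (cluster_var b c i) = alternating \<alpha> (i - r))"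
      using p by (auto simp: deep_points_def alternating_def)
    show "q = p" if "q \<in> deep_points b c \<and> (\<forall>i. q (cluster_var b c i) = alternating \<alpha> (i - r))"
      for q
      using that p by (intro points_eqI[of q b c p]) (auto simp: deep_points_def)
  qed
qed

text \<open>
  The sequence of values is alternating by the exchange relations; the condition on \<open>excess\<close> is the
  polynomial recursion at \<open>r\<close>, where the values at \<open>r - 2\<close>, \<open>r\<close> and \<open>r + 2\<close> are all \<open>0\<close>.
\<close>

lemma deep_point_alternating:
  fixes p :: "ratfun2 \<Rightarrow> 'k::field"
  assumes "b > 0" "c > 0" and deep: "p \<in> deep_points b c" and r: "p (cluster_var b c r) = 0"
  defines "e \<equiv> exchange_exp b c"
  shows "excess (e r) (e (r + 1)) (0 :: 'k) = 0 \<and>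
    (\<exists>\<alpha>. \<alpha> \<noteq> 0 \<and> \<alpha> ^ e (r + 1) = - 1 \<and>
      (\<forall>i. p (cluster_var b c i) = alternating \<alpha> (i - r)))"
proof -
  have p: "p \<in> points b c" using deep by (simp add: deep_points_def)
  obtain \<alpha> where \<alpha>: "\<alpha> \<noteq> 0" "\<alpha> ^ e (r + 1) = - 1"
    "\<And>i. p (cluster_var b c i) = alternating \<alpha> (i - r)"
    using alternating_if_deep[of "\<lambda>i. p (cluster_var b c i)" e r] point_exchange[OF p] r deep
      exchange_exp_pos[OF assms(1,2)]
    unfolding e_def deep_points_def by blast
  have "excess (e r) (e (r + 1)) (0 :: 'k) = 0"
    using point_skip[OF p assms(1,2), of r] by (simp add: \<alpha>(3) e_def alternating_def)
  then show ?thesis using \<alpha> by blast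
qed

lemma excess_zero_eq_0_iff:
  assumes "m > 0"
  shows "excess m n (0 :: 'k::field) = 0 \<longleftrightarrow> m > 1 \<or> CHAR('k) dvd n"
  using assms by (auto simp: excess_zero of_nat_eq_0_iff_char_dvd)

theorem corollary4p6:
  fixes b c :: nat
  assumes "b > 0" and "c > 0"
  shows
    "(c > 1 \<or> CHAR('k::field) dvd b \<longrightarrow>
      (\<forall>\<alpha>::'k. \<alpha> \<noteq> 0 \<and> \<alpha> ^ b = - 1 \<longrightarrow>
        (\<exists>!p. p \<in> deep_points b c \<and> even_zero_type b c p \<alpha>))) \<and>
     (b > 1 \<or> CHAR('k) dvd c \<longrightarrow>
      (\<forall>\<alpha>::'k. \<alpha> \<noteq> 0 \<and> \<alpha> ^ c = - 1 \<longrightarrow>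
        (\<exists>!p. p \<in> deep_points b c \<and> odd_zero_type b c p \<alpha>))) \<and>
     (\<forall>p \<in> (deep_points b c :: (ratfun2 \<Rightarrow> 'k) set).
       ((c > 1 \<or> CHAR('k) dvd b) \<and>
          (\<exists>\<alpha>. \<alpha> \<noteq> 0 \<and> \<alpha> ^ b = - 1 \<and> even_zero_type b c p \<alpha>) \<or>
        (b > 1 \<or> CHAR('k) dvd c) \<and>
          (\<exists>\<alpha>. \<alpha> \<noteq> 0 \<and> \<alpha> ^ c = - 1 \<and> odd_zero_type b c p \<alpha>)) \<and>
       \<not> ((\<exists>\<alpha>. \<alpha> \<noteq> 0 \<and> even_zero_type b c p \<alpha>) \<and>
          (\<exists>\<alpha>. \<alpha> \<noteq> 0 \<and> odd_zero_type b c p \<alpha>)))"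
proof (intro conjI ballI impI allI)
  have e: "exchange_exp b c 0 = c" "exchange_exp b c 1 = b" "exchange_exp b c 2 = c"
    by (simp_all add: exchange_exp_def)
  show "\<exists>!p. p \<in> deep_points b c \<and> even_zero_type b c p \<alpha>"
    if "c > 1 \<or> CHAR('k) dvd b" "\<alpha> \<noteq> 0 \<and> \<alpha> ^ b = - 1" for \<alpha> :: 'k
    unfolding even_zero_type_iff
    using that by (intro deep_point_exists assms) (simp_all add: e excess_zero_eq_0_iff assms)
  show "\<exists>!p. p \<in> deep_points b c \<and> odd_zero_type b c p \<alpha>"
    if "b > 1 \<or> CHAR('k) dvd c" "\<alpha> \<noteq> 0 \<and> \<alpha> ^ c = - 1" for \<alpha> :: 'k
    unfolding odd_zero_type_iff
    using that by (intro deep_point_exists assms) (simp_all add: e excess_zero_eq_0_iff assms)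
  fix p :: "ratfun2 \<Rightarrow> 'k"
  assume p: "p \<in> deep_points b c"
  then have "p (cluster_var b c 0) = 0 \<or> p (cluster_var b c (0 + 1)) = 0"
    unfolding deep_points_def by blast
  then have "p (cluster_var b c 0) = 0 \<or> p (cluster_var b c 1) = 0" by simp
  then show "(c > 1 \<or> CHAR('k) dvd b) \<and>
          (\<exists>\<alpha>. \<alpha> \<noteq> 0 \<and> \<alpha> ^ b = - 1 \<and> even_zero_type b c p \<alpha>) \<or>
        (b > 1 \<or> CHAR('k) dvd c) \<and>
          (\<exists>\<alpha>. \<alpha> \<noteq> 0 \<and> \<alpha> ^ c = - 1 \<and> odd_zero_type b c p \<alpha>)"
  proof
    assume "p (cluster_var b c 0) = 0"
    from deep_point_alternating[OF assms p this] show ?thesis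
      using excess_zero_eq_0_iff[OF assms(2), of b, where 'k = 'k]
      unfolding even_zero_type_iff by (simp add: e)
  next
    assume "p (cluster_var b c 1) = 0"
    from deep_point_alternating[OF assms p this] show ?thesis
      using excess_zero_eq_0_iff[OF assms(1), of c, where 'k = 'k]
      unfolding odd_zero_type_iff by (simp add: e)
  qed
  show "\<not> ((\<exists>\<alpha>. \<alpha> \<noteq> 0 \<and> even_zero_type b c p \<alpha>) \<and>
          (\<exists>\<alpha>. \<alpha> \<noteq> 0 \<and> odd_zero_type b c p \<alpha>))"
  proof
    assume "(\<exists>\<alpha>. \<alpha> \<noteq> 0 \<and> even_zero_type b c p \<alpha>) \<and>
          (\<exists>\<alpha>. \<alpha> \<noteq> 0 \<and> odd_zero_type b c p \<alpha>)"
    then obtain \<alpha> \<beta> where "\<alpha> \<noteq> 0" "even_zero_type b c p \<alpha>" "odd_zero_type b c p \<beta>" by blast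
    have "p (cluster_var b c 1) = \<alpha>"
      using \<open>even_zero_type b c p \<alpha>\<close> by (simp add: even_zero_type_def)
    moreover have "p (cluster_var b c 1) = 0"
      using \<open>odd_zero_type b c p \<beta>\<close> by (simp add: odd_zero_type_def)
    ultimately show False using \<open>\<alpha> \<noteq> 0\<close> by simp
  qed
qed

end
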